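(* Let $\mathcal{F}_m$ be a matrix-valued frieze (left or right) of period $p$ with entries $\mathfrak{M}_{i,j}$. 1. Transposing all the matrices in the non-trivial rows of $\mathcal{F}_m$ yields a new matrix-valued frieze, denoted $\mathcal{F}_m^{\ast}$. If $\mathcal{F}_m$ is a right matrix-valued frieze, then $\mathcal{F}_m^{\ast}$ is a left matrix-valued frieze. Hence if $\mathcal{F}_m$ is two-sided, then $\mathcal{F}_m^{\ast}$ is two-sided. 2. Assume that all the matrices of $\mathcal{F}_m$ commute with each other and let $x\in\mathbb{C}^l$ with $\|x\|=1$ be a common eigenvector of all matrices of $\mathcal{F}_m$. Then the array $\mathcal{F}_s(x)$ obtained by replacing each entry $A$ of $\mathcal{F}_m$ by the scalar $(Ax,x)_{\mathbb{C}^l}$ is a scalar frieze pattern with complex entries.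
   Context: Let $I$, $O$ be the $l\times l$ identity and zero matrices. A matrix-valued frieze of period $p$ (with $p-3$ non-trivial rows) is an array of $l\times l$ real matrices $\mathfrak{M}_{i,j}$, $i,j\in\mathbb{Z}$ with $i-2\le j\le i+p-2$, which is $p$-periodic ($\mathfrak{M}_{i+p,j+p}=\mathfrak{M}_{i,j}$), with $\mathfrak{M}_{i,i-2}=O=\mathfrak{M}_{i,i+p-2}$, $\mathfrak{M}_{i,i-1}=I=\mathfrak{M}_{i,i+p-3}$, and with $\mathfrak{M}_{i,j}\in GL_l(\mathbb{R})$ in the non-trivial rows $i\le j\le i+p-4$ (the row of index $d$ consists of the entries with $j-i=d$), satisfying one of the following rules. It is a left matrix-valued frieze if $$\mathfrak{M}_{i,j}\mathfrak{M}_{i+1,j+1}-\mathfrak{M}_{i,j+1}\mathfrak{M}_{i+1,j}=I$$ for all $i,j$ with $i-1\le j\le i+p-3$, a right matrix-valued frieze if $$\mathfrak{M}_{i+1,j+1}\mathfrak{M}_{i,j}-\mathfrak{M}_{i+1,j}\mathfrak{M}_{i,j+1}=I$$ for all such $i,j$, and two-sided if it is both left and right. A scalar frieze pattern with complex entries is an array of complex numbers $m_{i,j}$ of the same shape, with first and last rows ($j-i=-2$, $j-i=p-2$) consisting of $0$'s, second and next-to-last rows ($j-i=-1$, $j-i=p-3$) consisting of $1$'s, and satisfying the unimodular rule $m_{i,j}m_{i+1,j+1}-m_{i,j+1}m_{i+1,j}=1$ for all $i,j$ with $i-1\le j\le i+p-3$. $(\cdot,\cdot)_{\mathbb{C}^l}$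 is the standard Hermitian inner product. *)

theory Defs
  imports "HOL-Analysis.Analysis"
begin

text \<open>
  An array is a total function of two integer indices; only the entries inside the strip
  \<open>i - 2 \<le> j \<le> i + p - 2\<close> are meaningful, and nothing is required of the others.
\<close>

definition in_strip :: "int \<Rightarrow> int \<Rightarrow> int \<Rightarrow> bool" where
  "in_strip p i j \<longleftrightarrow> i - 2 \<le> j \<and> j \<le> i + p - 2"

definition nontrivial_row :: "int \<Rightarrow> int \<Rightarrow> int \<Rightarrow> bool" where
  "nontrivial_row p i j \<longleftrightarrow> i \<le> j \<and> j \<le> i + p - 4"

text \<open>
  The requirement \<open>p \<ge> 3\<close> makes the number \<open>p - 3\<close> of non-trivial rows nonnegative.
\<close>

definition matrix_array :: "int \<Rightarrow> (int \<Rightarrow> int \<Rightarrow> real^'l^'l) \<Rightarrow> bool" where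
  "matrix_array p M \<longleftrightarrow>
     p \<ge> 3 \<and>
     (\<forall>i j. in_strip p i j \<longrightarrow> M (i + p) (j + p) = M i j) \<and>
     (\<forall>i. M i (i - 2) = 0 \<and> M i (i + p - 2) = 0) \<and>
     (\<forall>i. M i (i - 1) = mat 1 \<and> M i (i + p - 3) = mat 1) \<and>
     (\<forall>i j. nontrivial_row p i j \<longrightarrow> invertible (M i j))"

definition left_matrix_frieze :: "int \<Rightarrow> (int \<Rightarrow> int \<Rightarrow> real^'l^'l) \<Rightarrow> bool" where
  "left_matrix_frieze p M \<longleftrightarrow>
     matrix_array p M \<and>
     (\<forall>i j. i - 1 \<le> j \<and> j \<le> i + p - 3 \<longrightarrow>
        M i j ** M (i + 1) (j + 1) - M i (j + 1) ** M (i + 1) j = mat 1)"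

definition right_matrix_frieze :: "int \<Rightarrow> (int \<Rightarrow> int \<Rightarrow> real^'l^'l) \<Rightarrow> bool" where
  "right_matrix_frieze p M \<longleftrightarrow>
     matrix_array p M \<and>
     (\<forall>i j. i - 1 \<le> j \<and> j \<le> i + p - 3 \<longrightarrow>
        M (i + 1) (j + 1) ** M i j - M (i + 1) j ** M i (j + 1) = mat 1)"

definition two_sided_matrix_frieze :: "int \<Rightarrow> (int \<Rightarrow> int \<Rightarrow> real^'l^'l) \<Rightarrow> bool" where
  "two_sided_matrix_frieze p M \<longleftrightarrow> left_matrix_frieze p M \<and> right_matrix_frieze p M"

definition matrix_frieze :: "int \<Rightarrow> (int \<Rightarrow> int \<Rightarrow> real^'l^'l) \<Rightarrow> bool" where
  "matrix_frieze p M \<longleftrightarrow> left_matrix_frieze p M \<or> right_matrix_frieze p M"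

definition transpose_frieze ::
    "int \<Rightarrow> (int \<Rightarrow> int \<Rightarrow> real^'l^'l) \<Rightarrow> int \<Rightarrow> int \<Rightarrow> real^'l^'l" where
  "transpose_frieze p M =
     (\<lambda>i j. if nontrivial_row p i j then transpose (M i j) else M i j)"

definition scalar_frieze :: "int \<Rightarrow> (int \<Rightarrow> int \<Rightarrow> complex) \<Rightarrow> bool" where
  "scalar_frieze p m \<longleftrightarrow>
     p \<ge> 3 \<and>
     (\<forall>i. m i (i - 2) = 0 \<and> m i (i + p - 2) = 0) \<and>
     (\<forall>i. m i (i - 1) = 1 \<and> m i (i + p - 3) = 1) \<and>
     (\<forall>i j. i - 1 \<le> j \<and> j \<le> i + p - 3 \<longrightarrow>
        m i j * m (i + 1) (j + 1) - m i (j + 1) * m (i + 1) j = 1)"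

definition complex_matrix :: "real^'l^'l \<Rightarrow> complex^'l^'l" where
  "complex_matrix A = map_matrix complex_of_real A"

text \<open>
  The library inner product on \<open>complex^'l\<close> is the real part of the Hermitian one, so the
  latter is defined here; the library norm is the Hermitian norm.
\<close>

definition hermitian_inner :: "complex^'l \<Rightarrow> complex^'l \<Rightarrow> complex" where
  "hermitian_inner u v = (\<Sum>a\<in>UNIV. u $ a * cnj (v $ a))"

definition is_eigenvector :: "complex^'l^'l \<Rightarrow> complex^'l \<Rightarrow> bool" where
  "is_eigenvector A x \<longleftrightarrow> x \<noteq> 0 \<and> (\<exists>c. A *v x = c *s x)"

definition entries_commute :: "int \<Rightarrow> (int \<Rightarrow> int \<Rightarrow> real^'l^'l) \<Rightarrow> bool" where
  "entries_commute p M \<longleftrightarrow>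
     (\<forall>i j i' j'. in_strip p i j \<and> in_strip p i' j' \<longrightarrow> M i j ** M i' j' = M i' j' ** M i j)"

definition common_eigenvector ::
    "int \<Rightarrow> (int \<Rightarrow> int \<Rightarrow> real^'l^'l) \<Rightarrow> complex^'l \<Rightarrow> bool" where
  "common_eigenvector p M x \<longleftrightarrow>
     (\<forall>i j. in_strip p i j \<longrightarrow> is_eigenvector (complex_matrix (M i j)) x)"

definition scalarized_frieze ::
    "(int \<Rightarrow> int \<Rightarrow> real^'l^'l) \<Rightarrow> complex^'l \<Rightarrow> int \<Rightarrow> int \<Rightarrow> complex" where
  "scalarized_frieze M x = (\<lambda>i j. hermitian_inner (complex_matrix (M i j) *v x) x)"

end

theory Submission
  imports Defs
begin

text \<open>Transposition reverses products and fixes the identity, so it exchanges the left and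
  right rules. The boundary rows consist of symmetric matrices, hence
  \<open>transpose_frieze\<close> is entrywise transposition on the whole strip
  (\<open>transpose_frieze_in_strip\<close>), and a rule can be transposed as a single equation. For
  the second claim, if \<open>x\<close> is a unit eigenvector of \<open>A\<close>, then (Ax,x) is
  its eigenvalue. So A \<mapsto> (Ax,x) is additive, sends the identity to 1, and is multiplicative
  on matrices having \<open>x\<close> as an eigenvector
  (\<open>hermitian_inner_eigenvector_mult\<close>). Applied to a matrix rule it gives the
  unimodular rule (\<open>scalarized_determinant_rule\<close>).\<close>

lemma transpose_diff: "transpose (A - B) = transpose A - transpose (B :: 'a::minus^'n^'m)"
  by (simp add: transpose_def vec_eq_iff)

text \<open>The rows outside the non-trivial range are 0 or the identity, and both are symmetric.
  This removes the case distinction in \<open>transpose_frieze\<close>.\<close>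

lemma transpose_frieze_in_strip:
  assumes "matrix_array p M" "in_strip p i j"
  shows "transpose_frieze p M i j = transpose (M i j)"
proof -
  consider "nontrivial_row p i j" | "j = i - 2" | "j = i - 1" | "j = i + p - 3" | "j = i + p - 2"
    using assms(2) unfolding in_strip_def nontrivial_row_def by linarith
  then show ?thesis
  proof cases
    case 1
    then show ?thesis by (simp add: transpose_frieze_def)
  \<comment> \<open>Writing 0 as \<open>mat 0\<close> lets \<open>transpose_mat\<close> settle the
    zero rows as well as the identity rows.\<close>
  qed (use assms(1) in \<open>simp_all add: transpose_frieze_def matrix_array_def transpose_mat
         flip: mat_0\<close>)
qed

lemma matrix_array_transpose_frieze:
  assumes "matrix_array p M"
  shows "matrix_array p (transpose_frieze p M)"
proof -
  have p: "p \<ge> 3"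
    using assms by (simp add: matrix_array_def)
  \<comment> \<open>The shift by \<open>p\<close> preserves \<open>j - i\<close>, so both sides take
    the same branch of the conditional.\<close>
  have "transpose_frieze p M (i + p) (j + p) = transpose_frieze p M i j" if "in_strip p i j" for i j
    using that assms by (simp add: transpose_frieze_def nontrivial_row_def matrix_array_def)
  moreover have "invertible (transpose_frieze p M i j)" if "nontrivial_row p i j" for i j
    using that assms by (simp add: transpose_frieze_def matrix_array_def transpose_invertible)
  ultimately show ?thesis
    using assms p unfolding matrix_array_def
    by (auto simp: transpose_frieze_def nontrivial_row_def)
qed

text \<open>The diamond of a rule never leaves the strip: in the extreme cases
  \<open>j = i - 1\<close> and \<open>j = i + p - 3\<close> it just touches a row of zeros.\<close>

lemma frieze_rule_in_strip:
  assumes "i - 1 \<le> j" "j \<le> i + p - 3"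
  shows "in_strip p i j" "in_strip p (i + 1) (j + 1)" "in_strip p i (j + 1)" "in_strip p (i + 1) j"
  using assms by (simp_all add: in_strip_def)

text \<open>Transposing the right rule at \<open>(i, j)\<close> reverses both products, which gives
  the left rule at the same position.\<close>

lemma left_matrix_frieze_transpose_frieze:
  assumes "right_matrix_frieze p M"
  shows "left_matrix_frieze p (transpose_frieze p M)"
proof -
  have arr: "matrix_array p M"
    using assms by (simp add: right_matrix_frieze_def)
  let ?T = "transpose_frieze p M"
  have "?T i j ** ?T (i + 1) (j + 1) - ?T i (j + 1) ** ?T (i + 1) j = mat 1"
    if ij: "i - 1 \<le> j" "j \<le> i + p - 3" for i j
  proof -
    have "transpose (M (i + 1) (j + 1) ** M i j - M (i + 1) j ** M i (j + 1)) = mat 1"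
      using assms ij by (simp add: right_matrix_frieze_def transpose_mat)
    then show ?thesis
      by (simp add: transpose_frieze_in_strip[OF arr] frieze_rule_in_strip[OF ij]
          transpose_diff matrix_transpose_mul)
  qed
  then show ?thesis
    using matrix_array_transpose_frieze[OF arr] by (simp add: left_matrix_frieze_def)
qed

lemma right_matrix_frieze_transpose_frieze:
  assumes "left_matrix_frieze p M"
  shows "right_matrix_frieze p (transpose_frieze p M)"
proof -
  have arr: "matrix_array p M"
    using assms by (simp add: left_matrix_frieze_def)
  let ?T = "transpose_frieze p M"
  have "?T (i + 1) (j + 1) ** ?T i j - ?T (i + 1) j ** ?T i (j + 1) = mat 1"
    if ij: "i - 1 \<le> j" "j \<le> i + p - 3" for i j
  proof -
    have "transpose (M i j ** M (i + 1) (j + 1) - M i (j + 1) ** M (i + 1) j) = mat 1"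
      using assms ij by (simp add: left_matrix_frieze_def transpose_mat)
    then show ?thesis
      by (simp add: transpose_frieze_in_strip[OF arr] frieze_rule_in_strip[OF ij]
          transpose_diff matrix_transpose_mul)
  qed
  then show ?thesis
    using matrix_array_transpose_frieze[OF arr] by (simp add: right_matrix_frieze_def)
qed

lemma hermitian_inner_same: "hermitian_inner x x = complex_of_real ((norm x)\<^sup>2)"
  unfolding hermitian_inner_def norm_vec_def L2_set_def
  \<comment> \<open>The embedded square must stay intact for \<open>complex_norm_square\<close> to
    match it.\<close>
  by (simp add: sum_nonneg complex_norm_square del: of_real_power)

lemma hermitian_inner_scale_left: "hermitian_inner (c *s u) v = c * hermitian_inner u v"
  by (simp add: hermitian_inner_def sum_distrib_left mult.assoc)

text \<open>Pairing Ax = cx with the unit vector \<open>x\<close> gives (Ax,x) = c.\<close>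

lemma eigenvector_mult_hermitian_inner:
  assumes "is_eigenvector A x" "norm x = 1"
  shows "A *v x = hermitian_inner (A *v x) x *s x"
  using assms by (auto simp: is_eigenvector_def hermitian_inner_scale_left hermitian_inner_same)

lemma complex_matrix_mult: "complex_matrix (A ** B) = complex_matrix A ** complex_matrix B"
  by (simp add: complex_matrix_def matrix_matrix_mult_def map_matrix_def vec_eq_iff)

lemma complex_matrix_diff: "complex_matrix (A - B) = complex_matrix A - complex_matrix B"
  by (simp add: complex_matrix_def map_matrix_def vec_eq_iff)

lemma complex_matrix_mat: "complex_matrix (mat c) = mat (complex_of_real c)"
  by (simp add: complex_matrix_def map_matrix_def mat_def vec_eq_iff)

lemma hermitian_inner_eigenvector_mult:
  assumes "is_eigenvector A x" "is_eigenvector B x" "norm x = 1"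
  shows "hermitian_inner ((A ** B) *v x) x = hermitian_inner (A *v x) x * hermitian_inner (B *v x) x"
proof -
  let ?h = "\<lambda>A. hermitian_inner (A *v x) x"
  have "(A ** B) *v x = A *v (?h B *s x)"
    using eigenvector_mult_hermitian_inner[OF assms(2,3)]
    by (simp flip: matrix_vector_mul_assoc)
  also have "\<dots> = ?h B *s (A *v x)"
    by (simp add: vector_scalar_commute)
  finally show ?thesis
    by (simp add: hermitian_inner_scale_left mult.commute)
qed

text \<open>Stated for four arbitrary matrices so that it serves both orders of
  multiplication.\<close>

lemma scalarized_determinant_rule:
  assumes "A ** B - C ** D = mat 1" "norm x = 1"
    and "is_eigenvector (complex_matrix A) x" "is_eigenvector (complex_matrix B) x"
    and "is_eigenvector (complex_matrix C) x" "is_eigenvector (complex_matrix D) x"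
  defines "h \<equiv> \<lambda>A. hermitian_inner (complex_matrix A *v x) x"
  shows "h A * h B - h C * h D = 1"
proof -
  have "h A * h B - h C * h D = h (A ** B) - h (C ** D)"
    using assms by (simp add: h_def complex_matrix_mult hermitian_inner_eigenvector_mult)
  also have "\<dots> = h (A ** B - C ** D)"
    by (simp add: h_def complex_matrix_diff matrix_vector_mult_diff_rdistrib hermitian_inner_def
        left_diff_distrib sum_subtractf)
  also have "\<dots> = 1"
    using assms(1,2) by (simp add: h_def complex_matrix_mat hermitian_inner_same)
  finally show ?thesis .
qed

lemma scalar_frieze_scalarized_frieze:
  fixes M :: "int \<Rightarrow> int \<Rightarrow> real^'l^'l"
  assumes fr: "matrix_frieze p M" and x: "norm x = 1" and ev: "common_eigenvector p M x"
  shows "scalar_frieze p (scalarized_frieze M x)"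
proof -
  let ?m = "scalarized_frieze M x"
  have arr: "matrix_array p M"
    using fr by (auto simp: matrix_frieze_def left_matrix_frieze_def right_matrix_frieze_def)
  have "?m i j * ?m (i + 1) (j + 1) - ?m i (j + 1) * ?m (i + 1) j = 1"
    if ij: "i - 1 \<le> j" "j \<le> i + p - 3" for i j
  proof -
    have e: "is_eigenvector (complex_matrix (M i j)) x"
        "is_eigenvector (complex_matrix (M (i + 1) (j + 1))) x"
        "is_eigenvector (complex_matrix (M i (j + 1))) x"
        "is_eigenvector (complex_matrix (M (i + 1) j)) x"
      using ev frieze_rule_in_strip[OF ij] by (simp_all add: common_eigenvector_def)
    \<comment> \<open>The two rules differ only in the order of the factors, which disappears once
      the entries become complex numbers.\<close>
    consider "M i j ** M (i + 1) (j + 1) - M i (j + 1) ** M (i + 1) j = mat 1"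
      | "M (i + 1) (j + 1) ** M i j - M (i + 1) j ** M i (j + 1) = mat 1"
      using fr ij by (auto simp: matrix_frieze_def left_matrix_frieze_def right_matrix_frieze_def)
    then show ?thesis
    proof cases
      case 1
      then show ?thesis
        using scalarized_determinant_rule[OF 1 x] e by (simp add: scalarized_frieze_def)
    next
      case 2
      then show ?thesis
        using scalarized_determinant_rule[OF 2 x] e
        by (simp add: scalarized_frieze_def mult.commute)
    qed
  qed
  \<comment> \<open>The boundary rows: zero matrices become 0, and identities become (x,x) =
    1.\<close>
  moreover have "hermitian_inner (complex_matrix 0 *v x) x = 0"
    using complex_matrix_mat[where 'a = 'l, of 0] by (simp add: hermitian_inner_def)
  moreover have "hermitian_inner (complex_matrix (mat 1) *v x) x = 1"
    using x by (simp add: complex_matrix_mat hermitian_inner_same)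
  ultimately show ?thesis
    using arr by (simp add: scalar_frieze_def matrix_array_def scalarized_frieze_def)
qed

theorem proposition40:
  fixes p :: int and M :: "int \<Rightarrow> int \<Rightarrow> real^'l^'l"
  assumes "matrix_frieze p M"
  shows
    "(matrix_frieze p (transpose_frieze p M) \<and>
      (right_matrix_frieze p M \<longrightarrow> left_matrix_frieze p (transpose_frieze p M)) \<and>
      (two_sided_matrix_frieze p M \<longrightarrow> two_sided_matrix_frieze p (transpose_frieze p M))) \<and>
     (\<forall>x :: complex^'l.
        entries_commute p M \<and> norm x = 1 \<and> common_eigenvector p M x \<longrightarrow>
        scalar_frieze p (scalarized_frieze M x))"
  using assms left_matrix_frieze_transpose_frieze[of p M]
    right_matrix_frieze_transpose_frieze[of p M] scalar_frieze_scalarized_frieze[of p M]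
  unfolding matrix_frieze_def two_sided_matrix_frieze_def by blast

end
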